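(* Let $q\ge1$, $n\ge2$, and let $\mathbf f_n(z)=I_qz^n+A_1z^{n-1}+\cdots+A_n$ ($A_j\in\mathbb C^{q\times q}$, $A_0:=I_q$) be a Hurwitz-type matrix polynomial with Markov parameters $(s_j)_{j\ge0}$, where $s_0,\dots,s_{n-1}$ is a Stieltjes positive sequence. Let $\mathcal A_n$ be the $nq\times nq$ block lower triangular matrix $$\mathcal A_n=\begin{pmatrix} I_q&0_q&\cdots&0_q&0_q\\ A_2^*&-I_q&\cdots&0_q&0_q\\ A_4^*&-A_2^*&\ddots&0_q&0_q\\ \vdots&\vdots&\ddots&\ddots&0_q\\ A_{2(n-1)}^*&-A_{2(n-2)}^*&\cdots&(-1)^nA_2^*&(-1)^{n+1}I_q\end{pmatrix},$$ where $A_k:=0_q$ for $k>n$; that is, for $0\le k\le\ell\le n-1$ the block in row $\ell$, column $k$ (indices from $0$) is $(-1)^kA_{2(\ell-k)}^*$, and all other blocks vanish. If $n=2m$, then the Markov parameters $(s_j)_{j=0}^{2m-1}$ are determined by $$\mathcal A_{2m}\,(s_0,s_1,\dots,s_{2m-1})^*=(A_1,A_3,\dots,A_{2m-1},0_q,\dots,0_q)^*.$$ If $n=2m+1$, then the Markov parameters $(s_j)_{j=0}^{2m}$ are determined by $$\mathcal A_{2m+1}\,(s_0,s_1,\dots,s_{2m})^*=(A_1,A_3,\dots,A_{2m+1},0_q,\dots,0_q)^*.$$ (That is, the stated block system holds and has the stated Markov parameters as its only solution; the right-hand sides are block columns with $n$ blocks.)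
   Context: **Hurwitz-type matrix (HTM) polynomials.** Write $\mathbf f_n(z)=\mathbf h_n(z^2)+z\,\mathbf g_n(z^2)$, where for $n=2m$: $\mathbf h_n(z)=I_qz^m+A_2z^{m-1}+\cdots+A_{2m}$, $\mathbf g_n(z)=A_1z^{m-1}+A_3z^{m-2}+\cdots+A_{2m-1}$; and for $n=2m+1$: $\mathbf h_n(z)=A_1z^m+A_3z^{m-1}+\cdots+A_{2m+1}$, $\mathbf g_n(z)=I_qz^m+A_2z^{m-1}+\cdots+A_{2m}$. $\mathbf f_n$ is an HTM polynomial if there are Hermitian positive definite $q\times q$ matrices $\mathbf c_0,\dots,\mathbf c_{m-1},\mathbf d_0,\dots,\mathbf d_{m-1}$ if $n=2m$ (resp. $\mathbf c_0,\dots,\mathbf c_m,\mathbf d_0,\dots,\mathbf d_{m-1}$ if $n=2m+1$) such that, as an identity of rational matrix functions, $\mathbf g_n(z)\mathbf h_n(z)^{-1}=K_0(z)$ (resp. $\mathbf h_n(z)(z\mathbf g_n(z))^{-1}=K_0(z)$), where $K_{m-1}(z)=(z\mathbf c_{m-1}+\mathbf d_{m-1}^{-1})^{-1}$ and $K_i(z)=\bigl(z\mathbf c_i+(\mathbf d_i+K_{i+1}(z))^{-1}\bigr)^{-1}$ for $i=m-2,\dots,0$ (resp. $K_m(z)=z^{-1}\mathbf c_m^{-1}$ and $K_i(z)=\bigl(z\mathbf c_i+(\mathbf d_i+K_{i+1}(z))^{-1}\bigr)^{-1}$ for $i=m-1,\dots,0$). **Markov parameters.** The Markov parameters $s_j\in\mathbb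 C^{q\times q}$ of $\mathbf f_n$ are defined by the Laurent expansion at infinity $\sum_{j\ge0}(-1)^js_jz^{-j-1}$ of $\mathbf g_n(z)\mathbf h_n(z)^{-1}$ if $n=2m$, resp. of $\mathbf h_n(z)(z\mathbf g_n(z))^{-1}$ if $n=2m+1$. **Stieltjes positivity.** $H_{1,j}=(s_{a+b})_{a,b=0}^{j}$, $H_{2,j}=(s_{a+b+1})_{a,b=0}^{j}$. A sequence $(s_j)_{j=0}^{\kappa}$ is Stieltjes positive if $H_{1,j}$ is Hermitian positive definite whenever $2j\le\kappa$ and $H_{2,j}$ is Hermitian positive definite whenever $2j+1\le\kappa$ (in particular all $s_j$ are Hermitian). $(B_0,\dots,B_k)^*$ denotes the conjugate transpose of the block row, i.e. the block column with blocks $B_0^*,\dots,B_k^*$. *)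

theory Defs
  imports
    Complex_Main
    "HOL-Computational_Algebra.Polynomial_Factorial"
    "Jordan_Normal_Form.Gauss_Jordan_Elimination"
    "Jordan_Normal_Form.Determinant"
    "Jordan_Normal_Form.Schur_Decomposition"
begin

text \<open>The inverse is used for constant, complex and rational-function matrices alike; it is
  meaningful only for invertible arguments, which is the case wherever it is applied below.\<close>

definition minv :: "'a :: field mat \<Rightarrow> 'a mat" where
  "minv M = the (mat_inverse M)"

lemma minv_inverse:
  fixes M :: "'a :: field mat"
  assumes M: "M \<in> carrier_mat q q" and det: "det M \<noteq> 0"
  shows "minv M \<in> carrier_mat q q" "M * minv M = 1\<^sub>m q" "minv M * M = 1\<^sub>m q"
proof -
  have "M \<in> Units (ring_mat TYPE('a) q ())"
    using det_non_zero_imp_unit[OF M det] .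
  then obtain B where "mat_inverse M = Some B"
    using mat_inverse(1)[OF M, where b = "()"] by (cases "mat_inverse M") auto
  with mat_inverse(2)[OF M this]
  show "minv M \<in> carrier_mat q q" "M * minv M = 1\<^sub>m q" "minv M * M = 1\<^sub>m q"
    by (auto simp: minv_def)
qed

definition block_mat :: "nat \<Rightarrow> nat \<Rightarrow> nat \<Rightarrow> (nat \<Rightarrow> nat \<Rightarrow> complex mat) \<Rightarrow> complex mat" where
  "block_mat q N M B =
     mat (N * q) (M * q) (\<lambda>(i, j). B (i div q) (j div q) $$ (i mod q, j mod q))"

definition block_row :: "nat \<Rightarrow> nat \<Rightarrow> (nat \<Rightarrow> complex mat) \<Rightarrow> complex mat" where
  "block_row q M B = block_mat q 1 M (\<lambda>_ l. B l)"

definition herm_pos_def :: "nat \<Rightarrow> complex mat \<Rightarrow> bool" where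
  "herm_pos_def N M \<longleftrightarrow>
     M \<in> carrier_mat N N \<and> mat_adjoint M = M \<and>
     (\<forall>v \<in> carrier_vec N. v \<noteq> 0\<^sub>v N \<longrightarrow> 0 < Re ((M *\<^sub>v v) \<bullet>c v))"

text \<open>\<open>mat_poly q d B\<close> is the matrix polynomial \<open>B 0 * z^d + B 1 * z^(d-1) + ... + B d\<close>
  with \<open>q\<close>-by-\<open>q\<close> coefficients. A monic \<open>f = mat_poly q n A\<close> is represented below by its
  coefficient sequence \<open>A\<close>, where \<open>A 0\<close> is the identity and \<open>A k = 0\<close> for \<open>k > n\<close>.\<close>

definition mat_poly :: "nat \<Rightarrow> nat \<Rightarrow> (nat \<Rightarrow> complex mat) \<Rightarrow> complex poly mat" where
  "mat_poly q d B = mat q q (\<lambda>(i, j). \<Sum>k\<le>d. monom (B k $$ (i, j)) (d - k))"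

definition mat_eval :: "complex poly mat \<Rightarrow> complex \<Rightarrow> complex mat" where
  "mat_eval P z = map_mat (\<lambda>p. poly p z) P"

definition h_part :: "nat \<Rightarrow> nat \<Rightarrow> (nat \<Rightarrow> complex mat) \<Rightarrow> complex poly mat" where
  "h_part q n A =
     (if even n then mat_poly q (n div 2) (\<lambda>k. A (2 * k))
      else mat_poly q (n div 2) (\<lambda>k. A (2 * k + 1)))"

definition g_part :: "nat \<Rightarrow> nat \<Rightarrow> (nat \<Rightarrow> complex mat) \<Rightarrow> complex poly mat" where
  "g_part q n A =
     (if even n then mat_poly q (n div 2 - 1) (\<lambda>k. A (2 * k + 1))
      else mat_poly q (n div 2) (\<lambda>k. A (2 * k)))"

lemma mat_poly_split:
  assumes "n \<ge> 1"
  shows "mat_eval (mat_poly q n A) z =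
    mat_eval (h_part q n A) (z\<^sup>2) + z \<cdot>\<^sub>m mat_eval (g_part q n A) (z\<^sup>2)"
proof -
  have sp: "(\<Sum>k\<le>2 * m. F k) = (\<Sum>k\<le>m. F (2 * k)) + (\<Sum>k<m. F (2 * k + 1))"
    for m and F :: "nat \<Rightarrow> complex"
    by (induction m) (auto simp: algebra_simps)
  have main: "(\<Sum>k\<le>n. a k * z ^ (n - k)) =
      (if even n then (\<Sum>k\<le>n div 2. a (2 * k) * (z\<^sup>2) ^ (n div 2 - k))
          + z * (\<Sum>k\<le>n div 2 - 1. a (2 * k + 1) * (z\<^sup>2) ^ (n div 2 - 1 - k))
       else (\<Sum>k\<le>n div 2. a (2 * k + 1) * (z\<^sup>2) ^ (n div 2 - k))
          + z * (\<Sum>k\<le>n div 2. a (2 * k) * (z\<^sup>2) ^ (n div 2 - k)))" for a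
  proof (cases "even n")
    case True
    then obtain m' where "n = 2 * m'" by blast
    with assms obtain m where n: "n = 2 * Suc m" by (cases m') auto
    have e1: "z ^ (n - 2 * k) = (z\<^sup>2) ^ (Suc m - k)" for k
      by (simp add: n power_mult[symmetric] diff_mult_distrib2)
    have e2: "z ^ (n - (2 * k + 1)) = z * (z\<^sup>2) ^ (m - k)" if "k \<le> m" for k
    proof -
      have "n - (2 * k + 1) = Suc (2 * (m - k))" using that n by simp
      then show ?thesis by (simp only: power_Suc power_mult)
    qed
    have "(\<Sum>k\<le>n. a k * z ^ (n - k)) = (\<Sum>k\<le>Suc m. a (2 * k) * z ^ (n - 2 * k))
        + (\<Sum>k\<le>m. a (2 * k + 1) * z ^ (n - (2 * k + 1)))"
      using sp[of "\<lambda>k. a k * z ^ (n - k)" "Suc m"] n lessThan_Suc_atMost by simp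
    also have "(\<Sum>k\<le>m. a (2 * k + 1) * z ^ (n - (2 * k + 1))) =
        z * (\<Sum>k\<le>m. a (2 * k + 1) * (z\<^sup>2) ^ (m - k))"
      unfolding sum_distrib_left
      by (rule sum.cong[OF refl], subst e2) (simp_all add: mult.left_commute)
    finally show ?thesis unfolding e1 using True n by simp
  next
    case False
    then obtain m where n: "n = 2 * m + 1" by (elim oddE)
    have e1: "z ^ (n - (2 * k + 1)) = (z\<^sup>2) ^ (m - k)" for k
      by (simp add: n power_mult[symmetric] diff_mult_distrib2)
    have e2: "z ^ (n - 2 * k) = z * (z\<^sup>2) ^ (m - k)" if "k \<le> m" for k
    proof -
      have "n - 2 * k = Suc (2 * (m - k))" using that n by simp
      then show ?thesis by (simp only: power_Suc power_mult)
    qed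
    have "(\<Sum>k\<le>n. a k * z ^ (n - k)) = (\<Sum>k\<le>m. a (2 * k) * z ^ (n - 2 * k))
        + (\<Sum>k\<le>m. a (2 * k + 1) * z ^ (n - (2 * k + 1)))"
      using sp[of "\<lambda>k. a k * z ^ (n - k)" m] n
      by (simp add: lessThan_Suc_atMost[symmetric])
    also have "(\<Sum>k\<le>m. a (2 * k) * z ^ (n - 2 * k)) =
        z * (\<Sum>k\<le>m. a (2 * k) * (z\<^sup>2) ^ (m - k))"
      unfolding sum_distrib_left
      by (rule sum.cong[OF refl], subst e2) (simp_all add: mult.left_commute)
    finally show ?thesis unfolding e1 using False n by simp
  qed
  show ?thesis
    by (rule eq_matI)
      (auto simp: mat_eval_def mat_poly_def h_part_def g_part_def poly_sum poly_monom main)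
qed

definition rat_mat :: "complex poly mat \<Rightarrow> complex poly fract mat" where
  "rat_mat P = map_mat to_fract P"

definition const_mat :: "complex mat \<Rightarrow> complex poly fract mat" where
  "const_mat M = map_mat (\<lambda>a. to_fract [:a:]) M"

definition rat_z :: "complex poly fract" where
  "rat_z = to_fract [:0, 1:]"

definition htm_step ::
  "complex mat \<Rightarrow> complex mat \<Rightarrow> complex poly fract mat \<Rightarrow> complex poly fract mat" where
  "htm_step c d K = minv (rat_z \<cdot>\<^sub>m const_mat c + minv (const_mat d + K))"

definition htm_polynomial :: "nat \<Rightarrow> nat \<Rightarrow> (nat \<Rightarrow> complex mat) \<Rightarrow> bool" where
  "htm_polynomial q n A \<longleftrightarrow>
    (let m = n div 2; h = rat_mat (h_part q n A); g = rat_mat (g_part q n A) in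
     if even n then
       (\<exists>c d K. (\<forall>i<m. herm_pos_def q (c i)) \<and> (\<forall>i<m. herm_pos_def q (d i)) \<and>
          K (m - 1) = minv (rat_z \<cdot>\<^sub>m const_mat (c (m - 1)) + minv (const_mat (d (m - 1)))) \<and>
          (\<forall>i. i + 1 < m \<longrightarrow> K i = htm_step (c i) (d i) (K (i + 1))) \<and>
          g * minv h = K 0)
     else
       (\<exists>c d K. (\<forall>i\<le>m. herm_pos_def q (c i)) \<and> (\<forall>i<m. herm_pos_def q (d i)) \<and>
          K m = inverse rat_z \<cdot>\<^sub>m minv (const_mat (c m)) \<and>
          (\<forall>i<m. K i = htm_step (c i) (d i) (K (i + 1))) \<and>
          h * minv (rat_z \<cdot>\<^sub>m g) = K 0))"

text \<open>The Laurent expansion at infinity is read analytically: it converges entrywise to the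
  rational matrix function for all sufficiently large \<open>\<bar>z\<bar>\<close>.\<close>

definition markov_parameters ::
  "nat \<Rightarrow> nat \<Rightarrow> (nat \<Rightarrow> complex mat) \<Rightarrow> (nat \<Rightarrow> complex mat) \<Rightarrow> bool" where
  "markov_parameters q n A s \<longleftrightarrow>
    (\<forall>j. s j \<in> carrier_mat q q) \<and>
    (\<forall>\<^sub>F z in at_infinity. \<forall>a<q. \<forall>b<q.
       (\<lambda>j. (- 1) ^ j * s j $$ (a, b) / z ^ (j + 1)) sums
       ((if even n
         then mat_eval (g_part q n A) z * minv (mat_eval (h_part q n A) z)
         else mat_eval (h_part q n A) z * minv (z \<cdot>\<^sub>m mat_eval (g_part q n A) z)) $$ (a, b)))"

text \<open>\<open>stieltjes_positive q \<kappa> s\<close> concerns the finite sequence \<open>s 0, ..., s \<kappa>\<close> only.\<close>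

definition stieltjes_positive :: "nat \<Rightarrow> nat \<Rightarrow> (nat \<Rightarrow> complex mat) \<Rightarrow> bool" where
  "stieltjes_positive q \<kappa> s \<longleftrightarrow>
    (\<forall>j. 2 * j \<le> \<kappa> \<longrightarrow>
       herm_pos_def ((j + 1) * q) (block_mat q (j + 1) (j + 1) (\<lambda>a b. s (a + b)))) \<and>
    (\<forall>j. 2 * j + 1 \<le> \<kappa> \<longrightarrow>
       herm_pos_def ((j + 1) * q) (block_mat q (j + 1) (j + 1) (\<lambda>a b. s (a + b + 1))))"

definition coeff_mat :: "nat \<Rightarrow> nat \<Rightarrow> (nat \<Rightarrow> complex mat) \<Rightarrow> complex mat" where
  "coeff_mat q n A =
    block_mat q n n (\<lambda>l k. if k \<le> l then (- 1) ^ k \<cdot>\<^sub>m mat_adjoint (A (2 * (l - k))) else 0\<^sub>m q q)"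

end

theory Submission
  imports Defs
begin

text \<open>
  Taking adjoints, the block in row \<open>l\<close> of the system reads
  \<open>\<Sum>k\<le>l. (-1)^k s_k A_{2(l-k)} = A_{2l+1}\<close>, where \<open>A_k = 0\<close> for \<open>k > n\<close>. This is what the
  definition of the Markov parameters says after clearing the denominator. In the variable
  \<open>w = 1/z\<close> the coefficients of even index form \<open>E(w) = \<Sum>j A_{2j} w^j\<close>, those of odd index form
  \<open>U(w) = \<Sum>j A_{2j+1} w^j\<close>, and for either parity of \<open>n\<close> the rational matrix function to be
  expanded is \<open>w U(w) E(w)^{-1}\<close>: for even \<open>n\<close> the even coefficients are those of \<open>h\<close>, for odd
  \<open>n\<close> those of \<open>z g\<close>, and in both cases the formal degree of the denominator exceeds that of
  the numerator by one. Hence \<open>(\<Sum>j (-1)^j s_j w^j) E(w) = U(w)\<close> for all small \<open>w \<noteq> 0\<close>, and comparing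
  coefficients gives the convolution identity (lemma \<open>markov_convolution\<close>). Dividing by \<open>E(w)\<close> is
  legitimate because \<open>E(0) = A_0 = I\<close>, so that \<open>det E(w)\<close> is close to 1.

  The solution is unique because the system is block lower triangular with diagonal blocks
  \<open>(-1)^l I\<close> and can be solved by forward substitution (lemma \<open>block_system_unique\<close>).
\<close>

section \<open>Power series at the origin\<close>

text \<open>Dividing out the lower powers, whose coefficients vanish by induction, turns \<open>a n\<close> into a
  constant term, and a constant term is the limit of its series at 0. The series is only required
  to vanish on a punctured neighbourhood, since the origin corresponds to \<open>z = \<infinity>\<close>.\<close>

lemma power_series_zero_coeff:
  fixes a :: "nat \<Rightarrow> complex"
  assumes zero: "\<forall>\<^sub>F w in at 0. (\<lambda>n. a n * w ^ n) sums 0"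
  shows "a n = 0"
proof (induction n rule: less_induct)
  case (less n)
  obtain r where r: "r > 0" "\<And>w. w \<noteq> 0 \<Longrightarrow> norm w < r \<Longrightarrow> (\<lambda>n. a n * w ^ n) sums 0"
    using zero by (auto simp: eventually_at)
  have tail: "(\<lambda>i. a (i + n) * w ^ i) sums 0" if w: "w \<noteq> 0" "norm w < r" for w
  proof -
    have "(\<lambda>i. a (i + n) * w ^ (i + n)) sums 0"
      using r(2)[OF w] sums_zero_iff_shift[of n "\<lambda>n. a n * w ^ n" 0] less by simp
    from sums_mult[OF this, of "inverse (w ^ n)"] show ?thesis
      using w(1) by (simp add: power_add field_simps)
  qed
  have "((\<lambda>_::complex. 0) \<longlongrightarrow> a (0 + n)) (at 0)"
    using powser_limit_0_strong[OF r(1), of "\<lambda>i. a (i + n)" "\<lambda>_. 0"] tail by simp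
  then show ?case
    by (simp add: tendsto_const_iff)
qed

text \<open>As the second factor is a polynomial, its product with the series is a finite sum of shifted
  copies of the series, so convergence at the single point \<open>w\<close> is enough.\<close>

lemma power_series_times_polynomial:
  fixes x b :: "nat \<Rightarrow> complex"
  assumes x: "(\<lambda>j. x j * w ^ j) sums S" and b: "\<And>j. j > d \<Longrightarrow> b j = 0"
  shows "(\<lambda>l. (\<Sum>k\<le>l. x k * b (l - k)) * w ^ l) sums (S * (\<Sum>j\<le>d. b j * w ^ j))"
proof -
  have shifted: "(\<lambda>l. if l < j then 0 else x (l - j) * b j * w ^ l) sums (S * (b j * w ^ j))" for j
    using sums_zero_iff_shift[of j "\<lambda>l. if l < j then 0 else x (l - j) * b j * w ^ l"]
      sums_mult2[OF x, of "b j * w ^ j"]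
    by (simp add: power_add mult_ac)
  have "(\<Sum>j\<le>d. if l < j then 0 else x (l - j) * b j * w ^ l) =
      (\<Sum>k\<le>l. x k * b (l - k)) * w ^ l" for l
  proof -
    have "(\<Sum>j\<le>d. if l < j then 0 else x (l - j) * b j * w ^ l) =
        (\<Sum>j\<le>l. x (l - j) * b j * w ^ l)"
      by (rule sum.mono_neutral_cong) (auto simp: b)
    also have "\<dots> = (\<Sum>k\<le>l. x k * b (l - k) * w ^ l)"
      by (rule sum.reindex_bij_witness[of _ "\<lambda>k. l - k" "\<lambda>k. l - k"]) auto
    finally show ?thesis by (simp add: sum_distrib_right)
  qed
  moreover have "(\<lambda>l. \<Sum>j\<le>d. if l < j then 0 else x (l - j) * b j * w ^ l) sums
      (\<Sum>j\<le>d. S * (b j * w ^ j))"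
    by (rule sums_sum) (rule shifted)
  ultimately show ?thesis by (simp add: sum_distrib_left)
qed

section \<open>Matrix polynomials near infinity\<close>

text \<open>For \<open>w \<noteq> 0\<close> this is \<open>w^d P(1/w)\<close>, where \<open>P\<close> is the matrix polynomial with leading
  coefficient \<open>B 0\<close>; see \<open>mat_eval_mat_poly_inverse\<close>.\<close>

definition rev_eval :: "nat \<Rightarrow> nat \<Rightarrow> (nat \<Rightarrow> complex mat) \<Rightarrow> complex \<Rightarrow> complex mat" where
  "rev_eval q d B w = mat q q (\<lambda>(a, b). \<Sum>k\<le>d. B k $$ (a, b) * w ^ k)"

lemma rev_eval_carrier [simp]: "rev_eval q d B w \<in> carrier_mat q q"
  by (simp add: rev_eval_def)

lemma mat_eval_mat_poly_inverse:
  assumes w: "w \<noteq> 0"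
  shows "mat_eval (mat_poly q d B) (inverse w) = inverse w ^ d \<cdot>\<^sub>m rev_eval q d B w"
proof -
  have "inverse w ^ (d - k) = inverse w ^ d * w ^ k" if "k \<le> d" for k
    using w that by (simp add: power_diff power_inverse field_simps)
  then show ?thesis
    by (intro eq_matI)
      (auto simp: mat_eval_def mat_poly_def rev_eval_def poly_sum poly_monom sum_distrib_left
        mult_ac intro!: sum.cong)
qed

text \<open>The determinant is continuous in \<open>w\<close>, by the Leibniz formula, and equals 1 at the origin.\<close>

lemma eventually_det_rev_eval_nonzero:
  assumes B0: "B 0 = 1\<^sub>m q"
  shows "\<forall>\<^sub>F w in at 0. det (rev_eval q d B w) \<noteq> 0"
proof -
  have det: "det (rev_eval q d B w) =
      (\<Sum>p | p permutes {0..<q}.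
        signof p * (\<Prod>i = 0..<q. \<Sum>k\<le>d. B k $$ (i, p i) * w ^ k))" for w
    unfolding det_def'[OF rev_eval_carrier]
    by (intro sum.cong refl arg_cong2[of _ _ _ _ "(*)"] prod.cong)
      (auto simp: rev_eval_def dest: permutes_in_image)
  have "rev_eval q d B 0 = 1\<^sub>m q"
    by (intro eq_matI) (auto simp: rev_eval_def B0 power_0_left if_distrib sum.delta cong: if_cong)
  then have "det (rev_eval q d B 0) = 1" by simp
  moreover have "((\<lambda>w. det (rev_eval q d B w)) \<longlongrightarrow> det (rev_eval q d B 0)) (at 0)"
    unfolding det by (intro tendsto_intros)
  ultimately show ?thesis
    using tendsto_imp_eventually_ne by fastforce
qed

lemma smult_smult_mat: "a \<cdot>\<^sub>m (b \<cdot>\<^sub>m M) = (a * b) \<cdot>\<^sub>m (M :: 'a :: semigroup_mult mat)"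
  by (intro eq_matI) (auto simp: mult.assoc)

text \<open>Numerator and denominator scale with \<open>w^{-e}\<close> and \<open>w^{-e-1}\<close>; the extra factor \<open>w\<close> that
  this leaves in the quotient is removed by the outer scalar.\<close>

lemma rescaled_quotient_times_denominator:
  fixes w :: "'a :: field"
  assumes w: "w \<noteq> 0" and H: "H \<in> carrier_mat q q" and G: "G \<in> carrier_mat q q"
    and det: "det H \<noteq> 0"
  shows "(inverse w \<cdot>\<^sub>m ((inverse w ^ e \<cdot>\<^sub>m G) * minv (inverse w ^ Suc e \<cdot>\<^sub>m H))) * H = G"
proof -
  let ?H = "inverse w ^ Suc e \<cdot>\<^sub>m H" and ?G = "inverse w ^ e \<cdot>\<^sub>m G"
  have carr: "?H \<in> carrier_mat q q" "?G \<in> carrier_mat q q" using G H by auto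
  have "det ?H \<noteq> 0" using w det by simp
  note inv = minv_inverse[OF carr(1) this]
  have cancel: "w ^ Suc e * inverse w ^ Suc e = 1"
    unfolding power_mult_distrib[symmetric] using w by simp
  have one: "1 \<cdot>\<^sub>m M = M" for M :: "'a mat" by (intro eq_matI) auto
  have "w ^ Suc e \<cdot>\<^sub>m ?H = H"
    by (simp only: smult_smult_mat cancel one)
  then have "(inverse w \<cdot>\<^sub>m (?G * minv ?H)) * H =
      (inverse w \<cdot>\<^sub>m (?G * minv ?H)) * (w ^ Suc e \<cdot>\<^sub>m ?H)" by simp
  also have "\<dots> = w ^ Suc e \<cdot>\<^sub>m ((inverse w \<cdot>\<^sub>m (?G * minv ?H)) * ?H)"
    using carr inv(1) by (intro mult_smult_distrib[of _ q q _ q]) auto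
  also have "(inverse w \<cdot>\<^sub>m (?G * minv ?H)) * ?H = inverse w \<cdot>\<^sub>m (?G * minv ?H * ?H)"
    using carr inv(1) by (intro mult_smult_assoc_mat[of _ q q _ q]) auto
  also have "?G * minv ?H * ?H = ?G * (minv ?H * ?H)"
    using carr inv(1) by (intro assoc_mult_mat[of _ q q _ q _ q]) auto
  also have "\<dots> = ?G" unfolding inv(3) using carr(2) by (rule right_mult_one_mat)
  also have "w ^ Suc e \<cdot>\<^sub>m (inverse w \<cdot>\<^sub>m ?G) = G"
    by (simp only: smult_smult_mat power_Suc[symmetric] cancel one)
  finally show ?thesis .
qed

section \<open>The convolution identity for the Markov parameters\<close>

text \<open>Here \<open>F\<close> is \<open>z\<close> times the rational matrix function that defines the Markov parameters, taken
  at \<open>z = 1/w\<close>. The formal degrees \<open>n div 2\<close> of \<open>E\<close> and \<open>(n - 1) div 2\<close> of \<open>U\<close> make one formula serve both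
  parities of \<open>n\<close>.\<close>

lemma markov_quotient_reversed:
  assumes A0: "A 0 = 1\<^sub>m q" and n: "n \<ge> 1"
    and markov: "markov_parameters q n A s"
  defines "E \<equiv> \<lambda>k. A (2 * k)" and "U \<equiv> \<lambda>k. A (2 * k + 1)"
  shows "\<forall>\<^sub>F w in at 0. \<exists>F \<in> carrier_mat q q.
      (\<forall>a<q. \<forall>b<q. (\<lambda>j. (- 1) ^ j * s j $$ (a, b) * w ^ j) sums (F $$ (a, b))) \<and>
      F * rev_eval q (n div 2) E w = rev_eval q ((n - 1) div 2) U w"
proof -
  let ?Q = "\<lambda>z. if even n
      then mat_eval (g_part q n A) z * minv (mat_eval (h_part q n A) z)
      else mat_eval (h_part q n A) z * minv (z \<cdot>\<^sub>m mat_eval (g_part q n A) z)"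
  let ?e = "(n - 1) div 2"
  \<comment> \<open>The denominator carries the exponent \<open>Suc ?e\<close> for two reasons: for even \<open>n\<close> the formal
    degree of \<open>h\<close> exceeds that of \<open>g\<close> by one, and for odd \<open>n\<close> they agree but \<open>g\<close> is multiplied
    by \<open>z\<close>.\<close>
  have Q: "?Q (inverse w) = (inverse w ^ ?e \<cdot>\<^sub>m rev_eval q ?e U w) *
      minv (inverse w ^ Suc ?e \<cdot>\<^sub>m rev_eval q (n div 2) E w)" if w: "w \<noteq> 0" for w
  proof (cases "even n")
    case True
    then obtain m where m: "n = 2 * Suc m" using n
      by (metis One_nat_def Suc_le_D dvdE even_Suc_div_two mult_eq_0_iff not0_implies_Suc not_one_le_zero)
    have e: "?e = m" using m by simp
    show ?thesis unfolding e using w True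
      by (simp add: m h_part_def g_part_def mat_eval_mat_poly_inverse E_def U_def del: power_Suc)
  next
    case False
    then obtain m where m: "n = 2 * m + 1" by (elim oddE)
    show ?thesis using w False
      by (simp add: m h_part_def g_part_def mat_eval_mat_poly_inverse E_def U_def smult_smult_mat)
  qed
  have "\<forall>\<^sub>F z in at_infinity. \<forall>a<q. \<forall>b<q.
      (\<lambda>j. (- 1) ^ j * s j $$ (a, b) / z ^ (j + 1)) sums (?Q z $$ (a, b))"
    using markov by (simp only: markov_parameters_def)
  then have "\<forall>\<^sub>F w in at 0. \<forall>a<q. \<forall>b<q.
      (\<lambda>j. (- 1) ^ j * s j $$ (a, b) / inverse w ^ (j + 1)) sums (?Q (inverse w) $$ (a, b))"
    using filterlim_inverse_at_infinity unfolding filterlim_iff by blast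
  moreover have "\<forall>\<^sub>F w in at (0::complex). w \<noteq> 0"
    by (simp add: eventually_at_filter)
  moreover have "\<forall>\<^sub>F w in at 0. det (rev_eval q (n div 2) E w) \<noteq> 0"
    by (rule eventually_det_rev_eval_nonzero) (simp add: E_def A0)
  ultimately show ?thesis
  proof eventually_elim
    case (elim w)
    let ?H = "inverse w ^ Suc ?e \<cdot>\<^sub>m rev_eval q (n div 2) E w"
    have "det ?H \<noteq> 0" using elim by simp
    then have M: "minv ?H \<in> carrier_mat q q"
      using minv_inverse(1)[of ?H q] by simp
    have carr: "?Q (inverse w) \<in> carrier_mat q q"
      unfolding Q[OF elim(2)] using M by (meson mult_carrier_mat smult_carrier_mat rev_eval_carrier)
    show ?case
    proof (intro bexI[of _ "inverse w \<cdot>\<^sub>m ?Q (inverse w)"] conjI allI impI)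
      fix a b assume ab: "a < q" "b < q"
      have "(\<lambda>j. inverse w * ((- 1) ^ j * s j $$ (a, b) / inverse w ^ (j + 1))) sums
          (inverse w * ?Q (inverse w) $$ (a, b))"
        using elim(1) ab by (intro sums_mult) blast
      moreover have "(inverse w \<cdot>\<^sub>m ?Q (inverse w)) $$ (a, b) = inverse w * ?Q (inverse w) $$ (a, b)"
        using carr ab by (intro index_smult_mat(1)) auto
      moreover have "inverse w * (x / inverse w ^ (j + 1)) = x * w ^ j" for x j
        using elim(2) by (simp add: power_inverse field_simps)
      ultimately show "(\<lambda>j. (- 1) ^ j * s j $$ (a, b) * w ^ j) sums
          ((inverse w \<cdot>\<^sub>m ?Q (inverse w)) $$ (a, b))"
        by (simp only:)
    next
      show "(inverse w \<cdot>\<^sub>m ?Q (inverse w)) * rev_eval q (n div 2) E w = rev_eval q ?e U w"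
        unfolding Q[OF elim(2)]
        by (rule rescaled_quotient_times_denominator[of _ _ q]) (use elim in auto)
    next
      show "inverse w \<cdot>\<^sub>m ?Q (inverse w) \<in> carrier_mat q q"
        using carr by (rule smult_carrier_mat)
    qed
  qed
qed

lemma markov_convolution:
  assumes A0: "A 0 = 1\<^sub>m q"
    and An: "\<And>k. k > n \<Longrightarrow> A k = 0\<^sub>m q q" and n: "n \<ge> 1"
    and markov: "markov_parameters q n A s"
    and ab: "a < q" "b < q"
  shows "(\<Sum>k\<le>l. \<Sum>c<q. (- 1) ^ k * s k $$ (a, c) * A (2 * (l - k)) $$ (c, b)) =
    A (2 * l + 1) $$ (a, b)"
proof -
  define E where "E k = A (2 * k)" for k
  define U where "U k = A (2 * k + 1)" for k
  let ?x = "\<lambda>c k. (- 1) ^ k * s k $$ (a, c)"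
  let ?C = "\<lambda>l. \<Sum>c<q. \<Sum>k\<le>l. ?x c k * E (l - k) $$ (c, b)"
  let ?e = "(n - 1) div 2"
  have Ez: "E j $$ (c, b) = 0" if "j > n div 2" "c < q" for j c
    using that ab by (simp add: E_def An)
  have Uz: "U j $$ (a, b) = 0" if "j > ?e" for j
    using that ab n by (simp add: U_def An)
  have "\<forall>\<^sub>F w in at 0. (\<lambda>l. (?C l - U l $$ (a, b)) * w ^ l) sums 0"
    using markov_quotient_reversed[OF A0 n markov, folded E_def U_def]
  proof eventually_elim
    case (elim w)
    then obtain F where F: "F \<in> carrier_mat q q"
      and ser: "\<And>c. c < q \<Longrightarrow> (\<lambda>j. ?x c j * w ^ j) sums (F $$ (a, c))"
      and eq: "F * rev_eval q (n div 2) E w = rev_eval q ?e U w"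
      using ab by blast
    have "(\<lambda>l. \<Sum>c<q. (\<Sum>k\<le>l. ?x c k * E (l - k) $$ (c, b)) * w ^ l) sums
        (\<Sum>c<q. F $$ (a, c) * (\<Sum>j\<le>n div 2. E j $$ (c, b) * w ^ j))"
      by (intro sums_sum power_series_times_polynomial ser Ez) auto
    moreover have "(\<Sum>c<q. F $$ (a, c) * (\<Sum>j\<le>n div 2. E j $$ (c, b) * w ^ j)) =
        (\<Sum>j\<le>?e. U j $$ (a, b) * w ^ j)"
    proof -
      have "(F * rev_eval q (n div 2) E w) $$ (a, b) = rev_eval q ?e U w $$ (a, b)"
        by (simp only: eq)
      then show ?thesis
        using F ab by (simp add: rev_eval_def scalar_prod_def lessThan_atLeast0)
    qed
    ultimately have "(\<lambda>l. ?C l * w ^ l) sums (\<Sum>j\<le>?e. U j $$ (a, b) * w ^ j)"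
      by (simp add: sum_distrib_right)
    moreover have "(\<lambda>l. U l $$ (a, b) * w ^ l) sums (\<Sum>j\<le>?e. U j $$ (a, b) * w ^ j)"
      by (rule sums_finite) (use Uz in auto)
    ultimately show ?case
      using sums_diff by (fastforce simp: left_diff_distrib)
  qed
  from power_series_zero_coeff[OF this, of l] have "?C l = U l $$ (a, b)" by simp
  then show ?thesis
    by (subst sum.swap) (simp add: E_def U_def)
qed

section \<open>The block system\<close>

lemma mat_adjoint_index:
  assumes "i < dim_col M" "j < dim_row M"
  shows "mat_adjoint M $$ (i, j) = conjugate (M $$ (j, i))"
  using assms by (simp add: mat_adjoint_def mat_of_rows_def)

lemma mat_adjoint_carrier: "M \<in> carrier_mat r c \<Longrightarrow> mat_adjoint M \<in> carrier_mat c r"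
  by (intro carrier_matI) (auto simp: mat_adjoint_def)

lemma block_row_carrier: "block_row q N B \<in> carrier_mat q (N * q)"
  by (simp add: block_row_def block_mat_def)

lemma block_index_less:
  fixes k n q c :: nat
  assumes "k < n" "c < q"
  shows "k * q + c < n * q"
proof -
  have "k * q + c < Suc k * q" using assms(2) by simp
  also have "\<dots> \<le> n * q" using assms(1) by (intro mult_right_mono) auto
  finally show ?thesis .
qed

lemma sum_over_blocks:
  fixes f :: "nat \<Rightarrow> 'a :: comm_monoid_add"
  shows "(\<Sum>x<n * q. f x) = (\<Sum>k<n. \<Sum>c<q. f (k * q + c))"
proof -
  have block: "sum f {k * q..<k * q + q} = (\<Sum>c<q. f (k * q + c))" for k
    by (rule sum.reindex_bij_witness[of _ "\<lambda>c. k * q + c" "\<lambda>x. x - k * q"]) auto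
  show ?thesis
    unfolding block[symmetric] by (rule sum.nat_group[symmetric])
qed

lemma mat_adjoint_block_row_index:
  assumes "k < n" "a < q" "c < q"
  shows "mat_adjoint (block_row q n B) $$ (k * q + c, a) = cnj (B k $$ (a, c))"
  using assms block_index_less[of k n c q] block_row_carrier[of q n B]
  by (subst mat_adjoint_index) (auto simp: block_row_def block_mat_def)

lemma coeff_mat_index:
  assumes "\<And>k. A k \<in> carrier_mat q q" "l < n" "k < n" "b < q" "c < q"
  shows "coeff_mat q n A $$ (l * q + b, k * q + c) =
    (if k \<le> l then (- 1) ^ k * cnj (A (2 * (l - k)) $$ (c, b)) else 0)"
proof -
  have "mat_adjoint (A i) $$ (b, c) = cnj (A i $$ (c, b))" for i
    using assms(4,5) carrier_matD[OF assms(1)[of i]] by (subst mat_adjoint_index) auto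
  moreover have "dim_row (mat_adjoint (A i)) = q" "dim_col (mat_adjoint (A i)) = q" for i
    using mat_adjoint_carrier[OF assms(1)[of i]] by auto
  ultimately show ?thesis
    using assms(4,5) block_index_less[OF assms(2,4)] block_index_less[OF assms(3,5)]
    by (simp add: coeff_mat_def block_mat_def)
qed

text \<open>The adjoints in the system serve only to write the matrices \<open>t k\<close> as a block column while
  keeping the product \<open>t k * A (2 * (l - k))\<close> in this order: the entry of the left-hand side in
  position \<open>b\<close> of block row \<open>l\<close> and column \<open>a\<close> is the conjugate of an entry \<open>(a, b)\<close> of the
  convolution.\<close>

lemma block_system_iff:
  assumes A: "\<And>k. A k \<in> carrier_mat q q"
  shows "coeff_mat q n A * mat_adjoint (block_row q n t) = mat_adjoint (block_row q n R) \<longleftrightarrow>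
    (\<forall>l<n. \<forall>a<q. \<forall>b<q.
      (\<Sum>k\<le>l. \<Sum>c<q. (- 1) ^ k * t k $$ (a, c) * A (2 * (l - k)) $$ (c, b)) = R l $$ (a, b))"
    (is "?L = ?M \<longleftrightarrow> (\<forall>l<n. \<forall>a<q. \<forall>b<q. ?S l a b = _)")
proof -
  have coeff: "coeff_mat q n A \<in> carrier_mat (n * q) (n * q)"
    by (simp add: coeff_mat_def block_mat_def)
  have adj: "mat_adjoint (block_row q n B) \<in> carrier_mat (n * q) q" for B
    by (rule mat_adjoint_carrier[OF block_row_carrier])
  have L: "?L \<in> carrier_mat (n * q) q" using coeff adj by (rule mult_carrier_mat)
  have entry: "?L $$ (l * q + b, a) = cnj (?S l a b)" if l: "l < n" and a: "a < q" and b: "b < q"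
    for l a b
  proof -
    have "?L $$ (l * q + b, a) = (\<Sum>x<n * q. coeff_mat q n A $$ (l * q + b, x) *
        mat_adjoint (block_row q n t) $$ (x, a))"
      using coeff adj[of t] block_index_less[OF l b] a
      by (simp add: scalar_prod_def lessThan_atLeast0 carrier_matD)
    also have "\<dots> = (\<Sum>k<n. \<Sum>c<q. if k \<le> l
        then (- 1) ^ k * cnj (A (2 * (l - k)) $$ (c, b)) * cnj (t k $$ (a, c)) else 0)"
      unfolding sum_over_blocks
      by (intro sum.cong refl)
        (use l a b in \<open>simp add: coeff_mat_index[OF A] mat_adjoint_block_row_index\<close>)
    also have "\<dots> = (\<Sum>k\<le>l. \<Sum>c<q.
        (- 1) ^ k * cnj (A (2 * (l - k)) $$ (c, b)) * cnj (t k $$ (a, c)))"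
      by (rule sum.mono_neutral_cong_right) (use l in auto)
    also have "\<dots> = cnj (?S l a b)" by (simp add: mult_ac)
    finally show ?thesis .
  qed
  show ?thesis
  proof
    assume eq: "?L = ?M"
    show "\<forall>l<n. \<forall>a<q. \<forall>b<q. ?S l a b = R l $$ (a, b)"
    proof (intro allI impI)
      fix l a b assume *: "l < n" "a < q" "b < q"
      have "cnj (?S l a b) = cnj (R l $$ (a, b))"
        using entry[OF *] mat_adjoint_block_row_index[OF *, of R] eq by simp
      then show "?S l a b = R l $$ (a, b)" by (simp only: complex_cnj_cancel_iff)
    qed
  next
    assume *: "\<forall>l<n. \<forall>a<q. \<forall>b<q. ?S l a b = R l $$ (a, b)"
    show "?L = ?M"
    proof (rule eq_matI)
      fix i a assume "i < dim_row ?M" "a < dim_col ?M"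
      then have i: "i < n * q" and a: "a < q" using adj[of R] by auto
      define l b where "l = i div q" and "b = i mod q"
      have lb: "l < n" "b < q" and i_eq: "i = l * q + b"
        using i a by (auto simp: l_def b_def less_mult_imp_div_less)
      show "?L $$ (i, a) = ?M $$ (i, a)"
        unfolding i_eq using entry[of l a b] mat_adjoint_block_row_index[of l n a q b R] * lb a
        by simp
    qed (use L adj[of R] in auto)
  qed
qed

text \<open>Forward substitution: once the blocks before \<open>l\<close> agree, row \<open>l\<close> determines
  \<open>(-1)^l t l\<close>, because the diagonal coefficient is \<open>A 0 = I\<close>.\<close>

lemma block_system_unique:
  assumes A: "\<And>k. A k \<in> carrier_mat q q" and A0: "A 0 = 1\<^sub>m q"
    and s: "\<And>j. j < n \<Longrightarrow> s j \<in> carrier_mat q q" and t: "\<And>j. j < n \<Longrightarrow> t j \<in> carrier_mat q q"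
    and eq: "coeff_mat q n A * mat_adjoint (block_row q n t) = mat_adjoint (block_row q n R)"
    and sys: "coeff_mat q n A * mat_adjoint (block_row q n s) = mat_adjoint (block_row q n R)"
    and j: "j < n"
  shows "t j = s j"
  using j
proof (induction j rule: less_induct)
  case (less l)
  let ?F = "\<lambda>u k a b. \<Sum>c<q. (- 1) ^ k * u k $$ (a, c) * A (2 * (l - k)) $$ (c, b)"
  have top: "?F u l a b = (- 1) ^ l * u l $$ (a, b)" if "b < q" for u a b
    using that by (simp add: A0 if_distrib sum.delta cong: if_cong)
  show ?case
  proof (rule eq_matI)
    fix a b assume "a < dim_row (s l)" "b < dim_col (s l)"
    then have ab: "a < q" "b < q" using s[OF less.prems] by auto
    have "(\<Sum>k\<le>l. ?F u k a b) = R l $$ (a, b)"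
      if "coeff_mat q n A * mat_adjoint (block_row q n u) = mat_adjoint (block_row q n R)" for u
      using that[unfolded block_system_iff[OF A]] less.prems ab by blast
    from this[OF sys] this[OF eq]
    have "(\<Sum>k\<le>l. ?F t k a b) = (\<Sum>k\<le>l. ?F s k a b)" by simp
    moreover have "(\<Sum>k<l. ?F t k a b) = (\<Sum>k<l. ?F s k a b)"
      using less by (intro sum.cong) auto
    ultimately have "?F t l a b = ?F s l a b"
      by (simp add: lessThan_Suc_atMost[symmetric])
    then show "t l $$ (a, b) = s l $$ (a, b)" using ab by (simp only: top) simp
  qed (use s[OF less.prems] t[OF less.prems] in auto)
qed

theorem lemma7p1:
  fixes q n :: nat and A s :: "nat \<Rightarrow> complex mat"
  assumes "q \<ge> 1" and "n \<ge> 2"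
    and "\<And>k. A k \<in> carrier_mat q q"
    and "A 0 = 1\<^sub>m q"
    and "\<And>k. k > n \<Longrightarrow> A k = 0\<^sub>m q q"
    and "htm_polynomial q n A"
    and "markov_parameters q n A s"
    and "stieltjes_positive q (n - 1) s"
  shows
    "(\<forall>m. n = 2 * m \<longrightarrow>
      coeff_mat q n A * mat_adjoint (block_row q n s) =
        mat_adjoint (block_row q n (\<lambda>l. if l < m then A (2 * l + 1) else 0\<^sub>m q q)) \<and>
      (\<forall>t. (\<forall>j<n. t j \<in> carrier_mat q q) \<and>
         coeff_mat q n A * mat_adjoint (block_row q n t) =
           mat_adjoint (block_row q n (\<lambda>l. if l < m then A (2 * l + 1) else 0\<^sub>m q q))
         \<longrightarrow> (\<forall>j<n. t j = s j))) \<and>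
     (\<forall>m. n = 2 * m + 1 \<longrightarrow>
      coeff_mat q n A * mat_adjoint (block_row q n s) =
        mat_adjoint (block_row q n (\<lambda>l. if l \<le> m then A (2 * l + 1) else 0\<^sub>m q q)) \<and>
      (\<forall>t. (\<forall>j<n. t j \<in> carrier_mat q q) \<and>
         coeff_mat q n A * mat_adjoint (block_row q n t) =
           mat_adjoint (block_row q n (\<lambda>l. if l \<le> m then A (2 * l + 1) else 0\<^sub>m q q))
         \<longrightarrow> (\<forall>j<n. t j = s j)))"
proof -
  define R where "R l = A (2 * l + 1)" for l
  have s: "s j \<in> carrier_mat q q" for j
    using assms(7) by (simp add: markov_parameters_def)
  have n: "n \<ge> 1" using assms(2) by simp
  have system: "coeff_mat q n A * mat_adjoint (block_row q n s) = mat_adjoint (block_row q n R)"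
    unfolding block_system_iff[OF assms(3)]
    using markov_convolution[OF assms(4,5) n assms(7)] unfolding R_def by blast
  have unique: "t j = s j"
    if t: "\<forall>j<n. t j \<in> carrier_mat q q" and j: "j < n"
      and eq: "coeff_mat q n A * mat_adjoint (block_row q n t) = mat_adjoint (block_row q n R)"
    for t j
    using t by (intro block_system_unique[OF assms(3,4) s _ eq system j]) blast
  have claim: "coeff_mat q n A * mat_adjoint (block_row q n s) = mat_adjoint (block_row q n R') \<and>
      (\<forall>t. (\<forall>j<n. t j \<in> carrier_mat q q) \<and>
         coeff_mat q n A * mat_adjoint (block_row q n t) = mat_adjoint (block_row q n R')
         \<longrightarrow> (\<forall>j<n. t j = s j))" if "R' = R" for R'
    unfolding that using system unique by blast
  \<comment> \<open>The zero blocks on the right-hand side are the coefficients of odd index beyond \<open>n\<close>.\<close>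
  have even_rhs: "(\<lambda>l. if l < m then A (2 * l + 1) else 0\<^sub>m q q) = R" if "n = 2 * m" for m
    by (rule ext) (use assms(5) that in \<open>auto simp: R_def\<close>)
  have odd_rhs: "(\<lambda>l. if l \<le> m then A (2 * l + 1) else 0\<^sub>m q q) = R" if "n = 2 * m + 1" for m
    by (rule ext) (use assms(5) that in \<open>auto simp: R_def\<close>)
  show ?thesis
    by (rule conjI; intro allI impI; rule claim; rule even_rhs odd_rhs; assumption)
qed

end
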